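(* Let $n \geq 8$ be even, let $\omega_n := (1, 3, \ldots, n-1, n, n-2, \ldots, 2)$ be the cyclic order on $\{1,\ldots,n\}$ listing the odd numbers increasingly and then the even numbers decreasingly, and let $c_n$ be the edge-coloring of $C(n,\{2,3\})$ with colors red, black, purple, blue, green defined in the context. Then $(C(n,\{2,3\}),\omega_n,c_n)$ is a nearly dispersable matching book embedding.
   Context: All graphs are finite and simple. For a set $S=\{i_1<\cdots<i_k\}$ of integers with $k\ge 1$, $1\le i_1$ and $i_k\le \lfloor n/2\rfloor$, the circulant $C(n,S)$ is the graph on vertex set $\{1,\ldots,n\}$ in which each $j$ is adjacent to $j+i_r$ (addition mod $n$) for $r=1,\ldots,k$. Given a graph $G$ and a cyclic order $\omega$ on $V(G)$, draw the vertices on a circle in the order $\omega$ and the edges as straight chords; two edges cross if they intersect at a point that is not an endpoint. A matching book embedding $(G,\omega,c)$ consists of $G$, a cyclic order $\omega$, and an edge-coloring $c$ (the color classes are the pages) such that any two distinct edges of the same color neither cross nor share an endpoint. The embedding is nearly dispersable if the number of colors equals $1+\Delta(G)$, where $\Delta(G)$ is the maximum degree. The coloring $c_n$ ($n\ge 8$ even), writing $u{-}v$ for the edge joining $u$ and $v$: The edges of the Hamiltonian path $(n-3, n-5, \ldots, 1, n-1, 2, n, n-2, \ldots, 4)$ (odd numbers from $n-3$ down to $1$, then $n-1$, then $2$, then even numbers from $n$ down to $4$) are colored alternatingly red and black along the path (starting with either color). Purple: $2{-}5$, $4{-}7$, $\ldots$, $(n-4){-}(n-1)$, i.e. $a{-}(a+3)$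 for even $a$ with $2\le a\le n-4$. Blue: $1{-}4$, $3{-}6$, $\ldots$, $(n-3){-}n$, i.e. $a{-}(a+3)$ for odd $a$ with $1\le a\le n-3$. Green: $2{-}4$, $(n-3){-}(n-1)$, $3{-}n$, $1{-}(n-2)$. *)

theory Defs
  imports "HOL-Analysis.Analysis"
begin

record 'a graph =
  verts :: "'a set"
  edges :: "'a set set"

definition finite_simple_graph :: "'a graph \<Rightarrow> bool" where
  "finite_simple_graph G \<longleftrightarrow>
     finite (verts G) \<and> (\<forall>e\<in>edges G. e \<subseteq> verts G \<and> card e = 2)"

definition vertex_degree :: "'a graph \<Rightarrow> 'a \<Rightarrow> nat" where
  "vertex_degree G v = card {e \<in> edges G. v \<in> e}"

definition max_degree :: "'a graph \<Rightarrow> nat" where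
  "max_degree G = Max (vertex_degree G ` verts G)"

text \<open>Only meant for nonempty \<open>S \<subseteq> {1..n div 2}\<close>.\<close>

definition circulant :: "nat \<Rightarrow> nat set \<Rightarrow> nat graph" where
  "circulant n S =
     \<lparr>verts = {1..n},
      edges = {{j, k} | j k. j \<in> {1..n} \<and> k \<in> {1..n} \<and> (\<exists>s\<in>S. k mod n = (j + s) mod n)}\<rparr>"

text \<open>
  A cyclic order is represented by a list without repetitions, read up to rotation. In a drawing,
  the vertex \<open>v\<close> is the point of the unit circle with angle \<open>\<theta> v\<close>. Only differences of angles are
  constrained, and they are smaller than a full turn, so the list may be cut open anywhere and
  rotating it changes neither the points available for a drawing nor their cyclic order.
\<close>

definition circular_drawing :: "'a list \<Rightarrow> ('a \<Rightarrow> real) \<Rightarrow> bool" where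
  "circular_drawing \<omega> \<theta> \<longleftrightarrow>
     sorted_wrt (<) (map \<theta> \<omega>) \<and> (\<forall>u\<in>set \<omega>. \<forall>v\<in>set \<omega>. \<theta> v - \<theta> u < 2 * pi)"

text \<open>For an edge \<open>e = {u, v}\<close> this is the closed segment between the points of \<open>u\<close> and \<open>v\<close>.\<close>

definition chord :: "('a \<Rightarrow> real) \<Rightarrow> 'a set \<Rightarrow> complex set" where
  "chord \<theta> e = convex hull ((\<lambda>v. cis (\<theta> v)) ` e)"

definition edges_cross :: "('a \<Rightarrow> real) \<Rightarrow> 'a set \<Rightarrow> 'a set \<Rightarrow> bool" where
  "edges_cross \<theta> e f \<longleftrightarrow>
     (\<exists>x. x \<in> chord \<theta> e \<and> x \<in> chord \<theta> f \<and> x \<notin> (\<lambda>v. cis (\<theta> v)) ` (e \<union> f))"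

text \<open>
  Whether two edges cross does not depend on the drawing chosen for \<open>\<omega>\<close>; the definition asks for
  the absence of crossings in every drawing.
\<close>

definition matching_book_embedding ::
    "'a graph \<Rightarrow> 'a list \<Rightarrow> ('a set \<Rightarrow> 'c) \<Rightarrow> bool" where
  "matching_book_embedding G \<omega> c \<longleftrightarrow>
     finite_simple_graph G \<and> distinct \<omega> \<and> set \<omega> = verts G \<and>
     (\<forall>\<theta>. circular_drawing \<omega> \<theta> \<longrightarrow>
        (\<forall>e\<in>edges G. \<forall>f\<in>edges G. e \<noteq> f \<and> c e = c f \<longrightarrow>
           \<not> edges_cross \<theta> e f \<and> e \<inter> f = {}))"

definition nearly_dispersable ::
    "'a graph \<Rightarrow> 'a list \<Rightarrow> ('a set \<Rightarrow> 'c) \<Rightarrow> bool" where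
  "nearly_dispersable G \<omega> c \<longleftrightarrow> card (c ` edges G) = 1 + max_degree G"

definition omega :: "nat \<Rightarrow> nat list" where
  "omega n = filter odd [1..<n+1] @ rev (filter even [1..<n+1])"

definition ham_path :: "nat \<Rightarrow> nat list" where
  "ham_path n = rev (filter odd [1..<n-2]) @ [n - 1, 2] @ rev (filter even [4..<n+1])"

definition path_edges :: "nat \<Rightarrow> bool \<Rightarrow> nat set set" where
  "path_edges n b =
     {{ham_path n ! i, ham_path n ! Suc i} | i. Suc i < length (ham_path n) \<and> even i = b}"

datatype color = Red | Black | Purple | Blue | Green

text \<open>
  The flag \<open>red_first\<close> tells whether the alternating coloring of the path starts with red or
  with black.
\<close>

fun color_class :: "bool \<Rightarrow> nat \<Rightarrow> color \<Rightarrow> nat set set" where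
  "color_class red_first n Red = path_edges n red_first"
| "color_class red_first n Black = path_edges n (\<not> red_first)"
| "color_class red_first n Purple = {{a, a + 3} | a. even a \<and> 2 \<le> a \<and> a \<le> n - 4}"
| "color_class red_first n Blue = {{a, a + 3} | a. odd a \<and> 1 \<le> a \<and> a \<le> n - 3}"
| "color_class red_first n Green = {{2, 4}, {n - 3, n - 1}, {3, n}, {1, n - 2}}"

text \<open>
  For even \<open>n \<ge> 8\<close> the color classes partition the edges of \<open>circulant n {2, 3}\<close>; the value
  of the coloring outside these edges is irrelevant.
\<close>

definition coloring :: "bool \<Rightarrow> nat \<Rightarrow> nat set \<Rightarrow> color" where
  "coloring red_first n e = (THE k. e \<in> color_class red_first n k)"

end

theory Submission imports Defs begin

text \<open>Two chords of a circle are disjoint as soon as the endpoints of one lie on one open side of the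
  line through the other, and for points on the circle this only depends on the cyclic order of the
  four endpoints. Thus it suffices to compare positions in the order \<open>\<omega>\<^sub>n\<close>: purple and blue
  edges are parallel rungs between the odd and the even side, green is checked by hand, and
  non-consecutive edges of the Hamiltonian path do not interleave. Every vertex has degree 4.\<close>

section \<open>Chords of the unit circle\<close>

text \<open>Here \<open>t\<close> is closer to the midpoint of \<open>a\<close> and \<open>b\<close>
  than half of \<open>b - a\<close>, which is below pi, and cosine strictly decreases on
  [0, pi].\<close>

lemma cos_less_cos_shifted:
  fixes a b t :: real
  assumes "a < t" "t < b" "b - a < 2 * pi"
  shows "cos ((b - a) / 2) < cos (t - (a + b) / 2)"
proof -
  have "cos ((b - a) / 2) < cos \<bar>t - (a + b) / 2\<bar>"
    by (rule cos_monotone_0_pi) (use assms in \<open>auto simp: abs_if field_simps\<close>)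
  then show ?thesis by (simp only: cos_abs_real)
qed

text \<open>This is the preceding lemma for the complementary arc from \<open>b\<close> to
  \<open>a + 2 * pi\<close>: its midpoint and half-length involve a shift by pi, so both cosines
  change sign.\<close>

lemma cos_shifted_less_cos:
  fixes a b t :: real
  assumes "b < t" "t - a < 2 * pi" "a < b"
  shows "cos (t - (a + b) / 2) < cos ((b - a) / 2)"
proof -
  have *: "- cos x = cos (x - pi)" for x :: real
    by (simp add: cos_diff)
  have "cos ((a + 2 * pi - b) / 2) < cos (t - (b + (a + 2 * pi)) / 2)"
    by (rule cos_less_cos_shifted) (use assms in auto)
  also have "t - (b + (a + 2 * pi)) / 2 = (t - (a + b) / 2) - pi"
    by (simp add: field_simps)
  also have "cos \<dots> = - cos (t - (a + b) / 2)"
    using * by simp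
  also have "(a + 2 * pi - b) / 2 = - ((b - a) / 2 - pi)"
    by (simp add: field_simps)
  also have "cos \<dots> = - cos ((b - a) / 2)"
    using * by (simp only: cos_minus)
  finally show ?thesis by simp
qed

lemma inner_cis: "cis m \<bullet> cis t = cos (t - m)"
  by (simp add: inner_complex_def cos_diff)

text \<open>The normal of the line through \<open>cis (\<theta> u)\<close> and \<open>cis (\<theta> v)\<close> is the direction of the
  midpoint of the arc, so this line separates the open arc between them from the rest of the
  circle.\<close>

lemma not_edges_cross:
  fixes \<theta> :: "'a \<Rightarrow> real"
  assumes uv: "\<theta> u < \<theta> v"
    and turn: "\<And>s t. s \<in> {u, v} \<union> f \<Longrightarrow> t \<in> {u, v} \<union> f \<Longrightarrow> \<theta> t - \<theta> s < 2 * pi"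
    and sep: "(\<forall>x\<in>f. \<theta> u < \<theta> x \<and> \<theta> x < \<theta> v) \<or> (\<forall>x\<in>f. \<theta> x < \<theta> u \<or> \<theta> v < \<theta> x)"
  shows "\<not> edges_cross \<theta> {u, v} f"
proof -
  define m where "m = (\<theta> u + \<theta> v) / 2"
  define h where "h = cos ((\<theta> v - \<theta> u) / 2)"
  have "\<theta> u - m = - ((\<theta> v - \<theta> u) / 2)" "\<theta> v - m = (\<theta> v - \<theta> u) / 2"
    by (simp_all add: m_def field_simps)
  then have "cos (\<theta> u - m) = h" "cos (\<theta> v - m) = h"
    by (simp_all only: h_def cos_minus)
  then have "(\<lambda>w. cis (\<theta> w)) ` {u, v} \<subseteq> {z. cis m \<bullet> z = h}"
    by (auto simp: inner_cis)
  then have line: "chord \<theta> {u, v} \<subseteq> {z. cis m \<bullet> z = h}"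
    unfolding chord_def by (rule hull_minimal) (rule convex_hyperplane)
  have "chord \<theta> f \<subseteq> {z. cis m \<bullet> z > h} \<or> chord \<theta> f \<subseteq> {z. cis m \<bullet> z < h}"
    using sep
  proof (elim disjE)
    assume inside: "\<forall>x\<in>f. \<theta> u < \<theta> x \<and> \<theta> x < \<theta> v"
    have "(\<lambda>w. cis (\<theta> w)) ` f \<subseteq> {z. cis m \<bullet> z > h}"
      using inside turn[of u v]
      by (auto simp: inner_cis h_def m_def
          intro!: cos_less_cos_shifted)
    then have "chord \<theta> f \<subseteq> {z. cis m \<bullet> z > h}"
      unfolding chord_def by (rule hull_minimal) (rule convex_halfspace_gt)
    then show ?thesis ..
  next
    assume outside: "\<forall>x\<in>f. \<theta> x < \<theta> u \<or> \<theta> v < \<theta> x"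
    have "cos (\<theta> x - m) < h" if x: "x \<in> f" for x
      using outside x
    proof (elim ballE disjE)
      assume "\<theta> v < \<theta> x"
      then show ?thesis
        using turn[of u x] x uv unfolding m_def h_def by (intro cos_shifted_less_cos) auto
    next
      assume "\<theta> x < \<theta> u"
      \<comment> \<open>Negating all angles is a reflection that turns a point before
        \<open>u\<close> into one after the arc, the case already treated.\<close>
      then have "cos (- \<theta> x - (- \<theta> v + - \<theta> u) / 2) < cos ((- \<theta> u - - \<theta> v) / 2)"
        using turn[of x v] x uv by (intro cos_shifted_less_cos) auto
      moreover have "- \<theta> x - (- \<theta> v + - \<theta> u) / 2 = - (\<theta> x - m)"
        by (simp add: m_def field_simps)
      ultimately show ?thesis
        by (simp only: h_def cos_minus) simp
    qed auto
    then have "(\<lambda>w. cis (\<theta> w)) ` f \<subseteq> {z. cis m \<bullet> z < h}"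
      by (auto simp: inner_cis)
    then have "chord \<theta> f \<subseteq> {z. cis m \<bullet> z < h}"
      unfolding chord_def by (rule hull_minimal) (rule convex_halfspace_lt)
    then show ?thesis ..
  qed
  with line show ?thesis
    unfolding edges_cross_def by fastforce
qed

section \<open>From the cyclic order to positions\<close>

text \<open>The position of \<open>v\<close> in \<open>omega (2 * k)\<close>, up to an order isomorphism.\<close>

definition position :: "nat \<Rightarrow> nat \<Rightarrow> nat" where
  "position k v = (if odd v then v else 4 * k + 1 - v)"

lemma sorted_wrt_less_related:
  fixes xs :: "'a :: linorder list"
  assumes "sorted_wrt R xs" "sorted_wrt (<) xs" "x \<in> set xs" "y \<in> set xs" "x < y"
  shows "R x y"
  using assms by (induction xs) auto

lemma set_omega: "set (omega n) = {1..n}"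
  by (auto simp: omega_def)

lemma distinct_omega: "distinct (omega n)"
  by (auto simp: omega_def)

text \<open>Within each parity the angles follow one sorted half of \<open>omega\<close>; across
  parities, every even vertex has a position above 2k and a larger angle than every odd
  vertex.\<close>

lemma circular_drawing_position:
  assumes draw: "circular_drawing (omega (2 * k)) \<theta>"
    and "u \<in> {1..2 * k}" "v \<in> {1..2 * k}" and less: "position k u < position k v"
  shows "\<theta> u < \<theta> v"
proof -
  define odds where "odds = filter odd [1..<2 * k + 1]"
  define evens where "evens = filter even [1..<2 * k + 1]"
  have sorted: "sorted_wrt (<) odds" "sorted_wrt (<) evens"
    unfolding odds_def evens_def by (intro sorted_wrt_filter sorted_wrt_upt)+
  have "sorted_wrt (\<lambda>x y. \<theta> x < \<theta> y) (odds @ rev evens)"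
    using draw unfolding circular_drawing_def omega_def odds_def evens_def by (simp only: sorted_wrt_map)
  then have o: "sorted_wrt (\<lambda>x y. \<theta> x < \<theta> y) odds"
    and e: "sorted_wrt (\<lambda>x y. \<theta> y < \<theta> x) evens"
    and oe: "\<forall>x\<in>set odds. \<forall>y\<in>set evens. \<theta> x < \<theta> y"
    by (auto simp: sorted_wrt_append sorted_wrt_rev)
  have mem: "w \<in> set (if odd w then odds else evens)" if "w \<in> {1..2 * k}" for w
    using that by (auto simp: odds_def evens_def le_less)
  show ?thesis
  proof (cases "odd u"; cases "odd v")
    assume "odd u" "odd v"
    then show ?thesis
      using sorted_wrt_less_related[OF o sorted(1)] mem[of u] mem[of v] assms
      by (auto simp: position_def)
  next
    assume "odd u" "\<not> odd v"
    then show ?thesis using oe mem[of u] mem[of v] assms by auto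
  next
    assume "\<not> odd u" "odd v"
    then show ?thesis using assms by (auto simp: position_def)
  next
    assume "\<not> odd u" "\<not> odd v"
    then show ?thesis
      using sorted_wrt_less_related[OF e sorted(2), of v u] mem[of u] mem[of v] assms
      by (auto simp: position_def)
  qed
qed

definition between :: "nat \<Rightarrow> nat \<Rightarrow> nat \<Rightarrow> bool" where
  "between p q r \<longleftrightarrow> p < r \<and> r < q \<or> q < r \<and> r < p"

definition outside :: "nat \<Rightarrow> nat \<Rightarrow> nat \<Rightarrow> bool" where
  "outside p q r \<longleftrightarrow> r < p \<and> r < q \<or> p < r \<and> q < r"

text \<open>Symmetric in \<open>p\<close> and \<open>q\<close>, so the endpoints of an edge may come
  in any order. Strictness also rules out shared endpoints, so one condition yields both noncrossing
  and disjointness.\<close>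

definition separated :: "nat \<Rightarrow> nat \<Rightarrow> nat \<Rightarrow> nat \<Rightarrow> bool" where
  "separated p q r s \<longleftrightarrow>
     p \<noteq> q \<and> (between p q r \<and> between p q s \<or> outside p q r \<and> outside p q s)"

lemma separated_outside: "p \<noteq> q \<Longrightarrow> outside p q r \<Longrightarrow> outside p q s \<Longrightarrow> separated p q r s"
  by (simp add: separated_def)

lemma separated_between: "p \<noteq> q \<Longrightarrow> between p q r \<Longrightarrow> between p q s \<Longrightarrow> separated p q r s"
  by (simp add: separated_def)

lemma separated_swap: "separated p q r s \<Longrightarrow> separated q p r s"
  unfolding separated_def between_def outside_def by blast

definition separated_edges :: "nat \<Rightarrow> nat set \<Rightarrow> nat set \<Rightarrow> bool" where
  "separated_edges k e f \<longleftrightarrow> (\<exists>u v x y. e = {u, v} \<and> f = {x, y} \<and>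
     separated (position k u) (position k v) (position k x) (position k y))"

lemma separated_edges_disjoint: "separated_edges k e f \<Longrightarrow> e \<inter> f = {}"
  by (auto simp: separated_edges_def separated_def between_def outside_def)

lemma separated_edges_not_cross:
  assumes draw: "circular_drawing (omega (2 * k)) \<theta>"
    and sep: "separated_edges k e f" and sub: "e \<subseteq> {1..2 * k}" "f \<subseteq> {1..2 * k}"
  shows "\<not> edges_cross \<theta> e f"
proof -
  \<comment> \<open>The endpoints of \<open>e\<close> are named so that \<open>u\<close> precedes
    \<open>v\<close>, as \<open>not_edges_cross\<close> requires.\<close>
  obtain u v x y where e: "e = {u, v}" and f: "f = {x, y}"
    and s: "separated (position k u) (position k v) (position k x) (position k y)"
    and less: "position k u < position k v"
  proof -
    from sep obtain u v x y where *: "e = {u, v}" "f = {x, y}"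
      "separated (position k u) (position k v) (position k x) (position k y)"
      by (auto simp: separated_edges_def)
    show thesis
    proof (cases "position k u < position k v")
      case True
      with * show thesis by (intro that)
    next
      case False
      with *(3) have "position k v < position k u" by (simp add: separated_def)
      then show thesis
        using *(1,2) separated_swap[OF *(3)] that[of v u x y] by (metis insert_commute)
    qed
  qed
  note mono = circular_drawing_position[OF draw]
  have "\<theta> b - \<theta> a < 2 * pi" if "a \<in> {u, v} \<union> f" "b \<in> {u, v} \<union> f" for a b
  proof -
    have "a \<in> set (omega (2 * k))" "b \<in> set (omega (2 * k))"
      using that sub e unfolding set_omega by blast+
    then show ?thesis using draw by (auto simp: circular_drawing_def)
  qed
  moreover have "(\<forall>x\<in>f. \<theta> u < \<theta> x \<and> \<theta> x < \<theta> v) \<or> (\<forall>x\<in>f. \<theta> x < \<theta> u \<or> \<theta> v < \<theta> x)"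
  proof -
    from s less have
      "(\<forall>x\<in>f. position k u < position k x \<and> position k x < position k v) \<or>
       (\<forall>x\<in>f. position k x < position k u \<or> position k v < position k x)"
      unfolding separated_def between_def outside_def f by auto
    then show ?thesis
      using sub mono unfolding e by (meson insert_subset subsetD)
  qed
  ultimately show ?thesis
    unfolding e using mono[of u v] less sub e by (intro not_edges_cross) auto
qed

section \<open>The Hamiltonian path in closed form\<close>

text \<open>Indices start at 0: the descending odd vertices fill the indices below k - 1, then come
  2k - 1 and 2, and the evens from 2k down to 4 fill the indices after k.\<close>

definition path_vertex :: "nat \<Rightarrow> nat \<Rightarrow> nat" where
  "path_vertex k i =
     (if i + 1 < k then 2 * k - 3 - 2 * i
      else if i + 1 = k then 2 * k - 1
      else if i = k then 2
      else 4 * k + 2 - 2 * i)"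

lemma filter_odd_upt: "filter odd [1..<2 * m] = map (\<lambda>i. 2 * i + 1) [0..<m]"
  by (induction m) auto

lemma filter_even_upt: "filter even [4..<2 * m + 4] = map (\<lambda>i. 2 * i + 4) [0..<m]"
proof (induction m)
  case (Suc m)
  have "[4..<2 * Suc m + 4] = [4..<Suc (Suc (2 * m + 4))]" by simp
  also have "\<dots> = [4..<2 * m + 4] @ [2 * m + 4, 2 * m + 5]"
    by (simp only: upt_Suc) simp
  finally have "filter even [4..<2 * Suc m + 4] = filter even [4..<2 * m + 4] @ [2 * m + 4]"
    by (simp only: filter_append) simp
  then show ?case unfolding Suc by simp
qed simp

lemma ham_path_eq:
  assumes "k \<ge> 4"
  shows "ham_path (2 * k) = map (path_vertex k) [0..<2 * k]"
proof -
  \<comment> \<open>Both monotone runs of the path have m = k - 1 vertices.\<close>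
  obtain m where k: "k = m + 1"
    using assms by (metis add.commute le_add_diff_inverse2 le_trans one_le_numeral)
  have odds: "filter odd [1..<2 * k - 2] = map (\<lambda>i. 2 * i + 1) [0..<m]"
    using filter_odd_upt[of m] by (simp add: k)
  \<comment> \<open>The last entry 2k is split off because \<open>filter_even_upt\<close> needs an
    even upper bound.\<close>
  have "[4..<2 * k + 1] = [4..<2 * (m - 1) + 4] @ [2 * (m - 1) + 4]"
    using assms k by (subst upt_Suc_append[symmetric]) (auto simp: algebra_simps)
  then have evens: "filter even [4..<2 * k + 1] = map (\<lambda>i. 2 * i + 4) [0..<m]"
    using filter_even_upt[of "m - 1"] assms k by (cases m) auto
  show ?thesis
    unfolding ham_path_def odds evens
    by (rule nth_equalityI)
       (auto simp: k nth_append rev_nth path_vertex_def nth_Cons' not_less)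
qed

lemma path_edges_eq:
  assumes "k \<ge> 4"
  shows "path_edges (2 * k) b =
    {{path_vertex k i, path_vertex k (Suc i)} | i. Suc i < 2 * k \<and> even i = b}"
  unfolding path_edges_def ham_path_eq[OF assms] by (intro Collect_cong ex_cong1) auto

section \<open>Edges and degrees of the circulant\<close>

text \<open>Steps of at most 3 wrap around at most once, so the congruence becomes linear
  arithmetic.\<close>

lemma edges_circulant:
  assumes "k \<ge> 4"
  shows "edges (circulant (2 * k) {2, 3}) =
    {{u, v} | u v. u \<in> {1..2 * k} \<and> v \<in> {1..2 * k} \<and>
       (v = u + 2 \<or> v = u + 3 \<or> v + 2 * k = u + 2 \<or> v + 2 * k = u + 3)}"
proof -
  have "v mod (2 * k) = (u + s) mod (2 * k) \<longleftrightarrow> v = u + s \<or> v + 2 * k = u + s"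
    if "u \<in> {1..2 * k}" "v \<in> {1..2 * k}" "s \<in> {2, 3}" for u v s
  proof
    assume eq: "v mod (2 * k) = (u + s) mod (2 * k)"
    show "v = u + s \<or> v + 2 * k = u + s"
    proof (cases "v \<le> u + s")
      case True
      then have "2 * k dvd u + s - v" using eq by (metis mod_eq_dvd_iff_nat)
      then obtain q where q: "u + s - v = 2 * k * q" by (elim dvdE)
      have "s \<le> 3" using that by auto
      \<comment> \<open>The difference is at most 2k + 2, which is below 4k.\<close>
      then have "u + s - v < 2 * k * 2" using that assms by (simp, linarith)
      then have "2 * k * q < 2 * k * 2" by (simp only: q)
      then have "q < 2" by simp
      then have "q = 0 \<or> q = 1" by linarith
      then show ?thesis using q True by auto
    next
      case False
      then have "2 * k dvd v - (u + s)" using eq by (metis mod_eq_dvd_iff_nat nat_le_linear)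
      then have "v - (u + s) \<ge> 2 * k" using False by (intro dvd_imp_le) auto
      then show ?thesis using that by auto
    qed
  next
    assume "v = u + s \<or> v + 2 * k = u + s"
    then show "v mod (2 * k) = (u + s) mod (2 * k)"
      by (metis mod_add_self2)
  qed
  then have "(\<exists>s\<in>{2, 3}. v mod (2 * k) = (u + s) mod (2 * k)) \<longleftrightarrow>
      v = u + 2 \<or> v = u + 3 \<or> v + 2 * k = u + 2 \<or> v + 2 * k = u + 3"
    if "u \<in> {1..2 * k}" "v \<in> {1..2 * k}" for u v
    using that by auto
  then show ?thesis
    unfolding circulant_def graph.select_convs by (intro Collect_cong ex_cong1) blast
qed

lemma edges_circulantI:
  assumes "k \<ge> 4" "u \<in> {1..2 * k}" "v \<in> {1..2 * k}"
    and "v = u + 2 \<or> v = u + 3 \<or> v + 2 * k = u + 2 \<or> v + 2 * k = u + 3 \<or>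
         u = v + 2 \<or> u = v + 3 \<or> u + 2 * k = v + 2 \<or> u + 2 * k = v + 3"
  shows "{u, v} \<in> edges (circulant (2 * k) {2, 3})"
proof -
  let ?adj = "\<lambda>u v. v = u + 2 \<or> v = u + 3 \<or> v + 2 * k = u + 2 \<or> v + 2 * k = u + 3"
  have *: "{a, b} \<in> edges (circulant (2 * k) {2, 3})"
    if "a \<in> {1..2 * k}" "b \<in> {1..2 * k}" "?adj a b" for a b
    unfolding edges_circulant[OF assms(1)] using that by blast
  have "?adj u v \<or> ?adj v u" using assms(4) by blast
  then show ?thesis
    using *[of u v] *[of v u] assms(2,3) by (metis insert_commute)
qed

lemma vertex_degree_circulant:
  assumes "k \<ge> 4" "v \<in> {1..2 * k}"
  shows "vertex_degree (circulant (2 * k) {2, 3}) v = 4"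
proof -
  \<comment> \<open>Addition modulo 2k with representatives 1 to 2k; in \<open>D\<close> the
    backward steps by 3 and 2 become 2k - 3 and 2k - 2.\<close>
  define nbr where "nbr d = (if v + d \<le> 2 * k then v + d else v + d - 2 * k)" for d
  define D where "D = {2, 3, 2 * k - 3, 2 * k - 2}"
  have D: "d \<in> D \<longleftrightarrow> d = 2 \<or> d = 3 \<or> d = 2 * k - 3 \<or> d = 2 * k - 2" for d
    by (simp add: D_def)
  have "{e \<in> edges (circulant (2 * k) {2, 3}). v \<in> e} = (\<lambda>d. {v, nbr d}) ` D"
  proof (intro equalityI subsetI)
    fix e assume "e \<in> {e \<in> edges (circulant (2 * k) {2, 3}). v \<in> e}"
    then obtain w where w: "e = {v, w}" "w \<in> {1..2 * k}"
      and "w = v + 2 \<or> w = v + 3 \<or> w + 2 * k = v + 2 \<or> w + 2 * k = v + 3 \<or>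
       v = w + 2 \<or> v = w + 3 \<or> v + 2 * k = w + 2 \<or> v + 2 * k = w + 3"
      unfolding edges_circulant[OF assms(1)] by blast
    from this(3) have "w = nbr 2 \<or> w = nbr 3 \<or> w = nbr (2 * k - 3) \<or> w = nbr (2 * k - 2)"
      by (elim disjE) (use w(2) assms in \<open>auto simp: nbr_def\<close>)
    then show "e \<in> (\<lambda>d. {v, nbr d}) ` D"
      using w(1) D by blast
  next
    fix e assume "e \<in> (\<lambda>d. {v, nbr d}) ` D"
    then obtain d where d: "d = 2 \<or> d = 3 \<or> d = 2 * k - 3 \<or> d = 2 * k - 2"
      and e: "e = {v, nbr d}"
      using D by blast
    have "nbr d \<in> {1..2 * k}"
      using d assms unfolding nbr_def by auto
    moreover from d have "nbr d = v + 2 \<or> nbr d = v + 3 \<or> nbr d + 2 * k = v + 2 \<or>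
      nbr d + 2 * k = v + 3 \<or> v = nbr d + 2 \<or> v = nbr d + 3 \<or>
      v + 2 * k = nbr d + 2 \<or> v + 2 * k = nbr d + 3"
      by (elim disjE) (use assms in \<open>auto simp: nbr_def\<close>)
    ultimately have "e \<in> edges (circulant (2 * k) {2, 3})"
      unfolding e using assms by (intro edges_circulantI)
    then show "e \<in> {e \<in> edges (circulant (2 * k) {2, 3}). v \<in> e}"
      by (simp add: e)
  qed
  moreover have "inj_on (\<lambda>d. {v, nbr d}) D"
  proof (rule inj_onI)
    fix d d' assume "d \<in> D" "d' \<in> D" and "{v, nbr d} = {v, nbr d'}"
    then have "nbr d = nbr d'" by (auto simp: doubleton_eq_iff)
    moreover have "d < 2 * k" "d' < 2 * k"
      using \<open>d \<in> D\<close> \<open>d' \<in> D\<close> assms(1) unfolding D by auto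
    ultimately show "d = d'"
      using assms unfolding nbr_def by (auto split: if_splits)
  qed
  moreover have "card D = 4"
  proof -
    \<comment> \<open>This substitution shows the four offsets 2, 3, 2m + 5, 2m + 6 to be
      distinct.\<close>
    obtain m where "k = m + 4" using assms(1) by (metis add.commute le_Suc_ex)
    then show ?thesis by (simp add: D_def)
  qed
  ultimately show ?thesis
    by (simp add: vertex_degree_def card_image)
qed

section \<open>The color classes partition the edges\<close>

text \<open>Indices are traded for endpoints. The bounds on \<open>w\<close> leave out exactly {2k -
  3, 2k - 1} and {2, 4}, which are green.\<close>

lemma path_edge_cases:
  assumes "k \<ge> 4" "e \<in> path_edges (2 * k) b"
  obtains (odd) w where "odd w" "w + 5 \<le> 2 * k" "e = {w, w + 2}"
    | (even) w where "even w" "4 \<le> w" "w + 2 \<le> 2 * k" "e = {w, w + 2}"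
    | (ends) "e = {1, 2 * k - 1}" | "e = {2, 2 * k - 1}" | "e = {2, 2 * k}"
proof -
  obtain i where i: "Suc i < 2 * k" and e: "e = {path_vertex k i, path_vertex k (Suc i)}"
    using assms(2) unfolding path_edges_eq[OF assms(1)] by blast
  consider "i + 2 < k" | "i + 2 = k" | "i + 1 = k" | "i = k" | "i > k" by linarith
  then show thesis
  proof cases
    case 1
    then obtain m where "k = i + 3 + m" using le_Suc_ex[of "i + 3" k] by auto
    then show thesis
      by (intro that(1)[of "2 * m + 1"]) (auto simp: e path_vertex_def)
  next
    case 2
    then show thesis using assms(1) by (intro that(3)) (auto simp: e path_vertex_def)
  next
    case 3
    then show thesis using assms(1) by (intro that(4)) (auto simp: e path_vertex_def)
  next
    case 4
    then show thesis using assms(1) by (intro that(5)) (auto simp: e path_vertex_def)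
  next
    case 5
    then show thesis
      using i by (intro that(2)[of "2 * (2 * k - i)"]) (auto simp: e path_vertex_def)
  qed
qed

lemma color_class_subset:
  assumes k: "k \<ge> 4"
  shows "color_class b (2 * k) c \<subseteq> edges (circulant (2 * k) {2, 3})"
proof -
  have path: "path_edges (2 * k) b' \<subseteq> edges (circulant (2 * k) {2, 3})" for b'
  proof
    fix e assume "e \<in> path_edges (2 * k) b'"
    with k show "e \<in> edges (circulant (2 * k) {2, 3})"
      by (cases rule: path_edge_cases) (use k in \<open>auto intro!: edges_circulantI elim!: oddE\<close>)
  qed
  show ?thesis
  proof (cases c)
    case Purple
    then show ?thesis using k by (auto intro!: edges_circulantI[OF k])
  next
    case Blue
    then show ?thesis using k by (auto intro!: edges_circulantI[OF k])
  next
    case Green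
    then show ?thesis using k by (auto intro!: edges_circulantI[OF k])
  qed (use path in auto)
qed

text \<open>Steps by 2 without wrapping lie on the path, apart from two green edges; steps by 3
  without wrapping are blue or purple by parity. Of the five wrapping edges, three are on the path
  and two are green.\<close>

lemma edges_subset_color_class:
  assumes k: "k \<ge> 4"
  shows "edges (circulant (2 * k) {2, 3}) \<subseteq> (\<Union>c. color_class b (2 * k) c)"
proof
  fix e assume "e \<in> edges (circulant (2 * k) {2, 3})"
  then obtain u v where e: "e = {u, v}" and uv: "u \<in> {1..2 * k}" "v \<in> {1..2 * k}"
    and adj: "v = u + 2 \<or> v = u + 3 \<or> v + 2 * k = u + 2 \<or> v + 2 * k = u + 3"
    unfolding edges_circulant[OF k] by blast
  let ?goal = "e \<in> (\<Union>c. color_class b (2 * k) c)"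
  have path: ?goal
    if "Suc i < 2 * k" "path_vertex k i = x" "path_vertex k (Suc i) = y" "e = {x, y}" for i x y
  proof -
    have "e = {path_vertex k i, path_vertex k (Suc i)}"
      using that by simp
    then have "e \<in> path_edges (2 * k) (even i)"
      using that(1) unfolding path_edges_eq[OF k] by blast
    then have "e \<in> color_class b (2 * k) (if even i = b then Red else Black)"
      by (cases b) (auto split: if_splits)
    then show ?goal by blast
  qed
  have color: ?goal if "e \<in> color_class b (2 * k) c" for c
    using that by blast
  from adj show ?goal
  proof (elim disjE)
    assume v: "v = u + 2"
    consider "odd u" "u + 2 = 2 * k - 1" | "odd u" "u + 4 < 2 * k" | "u = 2" | "even u" "u \<ge> 4"
    proof (cases "odd u")
      case True
      then obtain m where "u = 2 * m + 1" by (elim oddE)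
      moreover from this have "m + 2 = k \<or> m + 2 < k"
        using v uv by auto
      ultimately have "u + 2 = 2 * k - 1 \<or> u + 4 < 2 * k" by auto
      then show ?thesis using True that by blast
    next
      case False
      then have "u = 2 \<or> u \<ge> 4"
        using uv by (auto elim!: evenE)
      then show ?thesis using False that by blast
    qed
    then show ?goal
    proof cases
      case 1
      then have "u = 2 * k - 3" "v = 2 * k - 1" using v by auto
      then show ?goal using e by (intro color[of Green]) simp
    next
      case 2
      then obtain m where "u = 2 * m + 1" by (elim oddE)
      then show ?goal
        \<comment> \<open>The path descends here, so the index is that of the larger endpoint
          \<open>v\<close> = 2m + 3.\<close>
        using e v 2 by (intro path[of "k - 3 - m" v u]) (auto simp: path_vertex_def)
    next
      case 3
      then show ?goal using e v by (intro color[of Green]) simp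
    next
      case 4
      then obtain m where "u = 2 * m" by (elim evenE)
      then show ?goal
        \<comment> \<open>Again the index of the larger endpoint, \<open>v\<close> = 2m + 2.\<close>
        using e v 4 uv by (intro path[of "2 * k - m" v u]) (auto simp: path_vertex_def)
    qed
  next
    assume v: "v = u + 3"
    show ?goal
    proof (cases "odd u")
      case True
      then show ?goal using e v uv k by (intro color[of Blue]) (auto intro!: exI[of _ u])
    next
      case False
      then obtain m where "u = 2 * m" by auto
      moreover from this have "1 \<le> m" "m + 2 \<le> k"
        using v uv by auto
      ultimately have "2 \<le> u" "u \<le> 2 * k - 4" by auto
      then show ?goal using e v False by (intro color[of Purple]) (auto intro!: exI[of _ u])
    qed
  next
    assume v: "v + 2 * k = u + 2"
    then consider "u = 2 * k - 1" "v = 1" | "u = 2 * k" "v = 2"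
      using uv by force
    then show ?goal
    proof cases
      case 1
      then show ?goal using e k by (intro path[of "k - 2" v u]) (auto simp: path_vertex_def)
    next
      case 2
      then show ?goal using e k by (intro path[of k v u]) (auto simp: path_vertex_def)
    qed
  next
    assume v: "v + 2 * k = u + 3"
    then consider "u = 2 * k - 2" "v = 1" | "u = 2 * k - 1" "v = 2" | "u = 2 * k" "v = 3"
      using uv by force
    then show ?goal
    proof cases
      case 1
      then show ?goal using e by (intro color[of Green]) (simp add: insert_commute)
    next
      case 2
      then show ?goal using e k by (intro path[of "k - 1" u v]) (auto simp: path_vertex_def)
    next
      case 3
      then show ?goal using e by (intro color[of Green]) (simp add: insert_commute)
    qed
  qed
qed

lemma position_path_vertex:
  assumes "k \<ge> 4" "i < 2 * k"
  shows "position k (path_vertex k i) =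
    (if i + 1 < k then 2 * k - 3 - 2 * i
     else if i + 1 = k then 2 * k - 1
     else if i = k then 4 * k - 1
     else 2 * i - 1)"
proof -
  consider "i + 1 < k" | "i + 1 = k" | "i = k" | "i > k" by linarith
  then show ?thesis
    by cases (use assms in \<open>auto simp: path_vertex_def position_def\<close>)
qed

text \<open>The branches of the position formula have disjoint ranges: up to 2k - 3, the value 2k -
  1, the value 4k - 1, and from 2k + 1 to 4k - 3. Each is injective.\<close>

lemma path_vertex_inj:
  assumes k: "k \<ge> 4" and i: "i < 2 * k" and j: "j < 2 * k"
    and eq: "path_vertex k i = path_vertex k j"
  shows "i = j"
proof -
  have "position k (path_vertex k i) = position k (path_vertex k j)" by (simp only: eq)
  then show ?thesis
    unfolding position_path_vertex[OF k i] position_path_vertex[OF k j]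
    using k i j by (simp split: if_splits; presburger)
qed

text \<open>Positions decrease along the odd part of the path and increase along the even part, so an
  edge encloses no later vertex, except that the two edges at the vertex 2 enclose all of them.\<close>

lemma path_vertex_separated:
  assumes "k \<ge> 4" "Suc i < j" "Suc j < 2 * k"
  shows "separated (position k (path_vertex k i)) (position k (path_vertex k (Suc i)))
      (position k (path_vertex k j)) (position k (path_vertex k (Suc j)))"
proof -
  note position_path_vertex[OF assms(1), simp]
  consider "i + 2 < k" | "i + 2 = k" | "i + 1 = k" | "i = k" | "i > k" by linarith
  then show ?thesis
  proof cases
    case 1
    then show ?thesis
      using assms by (intro separated_outside) (auto simp: outside_def)
  next
    case 2
    then show ?thesis
      using assms by (intro separated_outside) (auto simp: outside_def)
  next
    case 3
    then show ?thesis
      using assms by (intro separated_between) (auto simp: between_def)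
  next
    case 4
    then show ?thesis
      using assms by (intro separated_between) (auto simp: between_def)
  next
    case 5
    then show ?thesis
      using assms by (intro separated_outside) (auto simp: outside_def)
  qed
qed

lemma path_edges_disjoint:
  assumes k: "k \<ge> 4" and e: "e \<in> path_edges (2 * k) b" "e \<in> path_edges (2 * k) d"
  shows "b = d"
proof -
  from e obtain i j where ij: "Suc i < 2 * k" "Suc j < 2 * k" "even i = b" "even j = d"
    and "{path_vertex k i, path_vertex k (Suc i)} = {path_vertex k j, path_vertex k (Suc j)}"
    unfolding path_edges_eq[OF k] by blast
  \<comment> \<open>The crosswise match of endpoints is contradictory, so an edge determines its
    index and hence its parity.\<close>
  then have "i = j \<or> i = Suc j \<and> Suc i = j"
    unfolding doubleton_eq_iff using path_vertex_inj[OF k] by (meson Suc_lessD)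
  with ij show ?thesis by auto
qed

text \<open>Endpoints of path edges differ by 2, 2k - 3 or 2k - 2, never by 3 since k is at least 4;
  the green edges are compared one by one.\<close>

lemma path_edge_not_other:
  assumes k: "k \<ge> 4" and e: "e \<in> path_edges (2 * k) d" and c: "c \<in> {Purple, Blue, Green}"
  shows "e \<notin> color_class b (2 * k) c"
proof -
  have "e \<noteq> {a, a + 3}" for a
    using k e by (cases rule: path_edge_cases) (use k in \<open>auto simp: doubleton_eq_iff\<close>)
  moreover have "e \<noteq> {2, 4}" "e \<noteq> {2 * k - 3, 2 * k - 1}" "e \<noteq> {3, 2 * k}" "e \<noteq> {1, 2 * k - 2}"
    using k e by (cases rule: path_edge_cases; use k in \<open>auto simp: doubleton_eq_iff\<close>)+
  ultimately show ?thesis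
    using c by auto
qed

lemma color_class_disjoint:
  assumes k: "k \<ge> 4" and e: "e \<in> color_class b (2 * k) c" "e \<in> color_class b (2 * k) d"
  shows "c = d"
proof -
  have PB: "e \<notin> color_class b (2 * k) Blue" if "e \<in> color_class b (2 * k) Purple"
    using that by (auto simp: doubleton_eq_iff)
  \<comment> \<open>Endpoints of green edges differ by 2 or by 2k - 3, which is at least 5.\<close>
  have "{a, a + 3} \<noteq> {2, 4}" "{a, a + 3} \<noteq> {2 * k - 3, 2 * k - 1}" "{a, a + 3} \<noteq> {3, 2 * k}"
    "{a, a + 3} \<noteq> {1, 2 * k - 2}" for a
    using k by (auto simp: doubleton_eq_iff)
  then have PBG: "e \<notin> color_class b (2 * k) Green"
    if "e \<in> color_class b (2 * k) Purple \<or> e \<in> color_class b (2 * k) Blue"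
    using that by auto
  have RB: "\<not> (e \<in> path_edges (2 * k) b \<and> e \<in> path_edges (2 * k) (\<not> b))"
    using path_edges_disjoint[OF k] by blast
  note other = path_edge_not_other[OF k, of e]
  show ?thesis
    using e PB PBG RB other[of b c b] other[of b d b] other[of "\<not> b" c b] other[of "\<not> b" d b]
    by (cases c; cases d) (simp_all del: color_class.simps(3-5))
qed

section \<open>Separation within each color\<close>

text \<open>The disjunction lets the edge that is earlier on the path, or the outer rung, act as the
  separating chord.\<close>

lemma color_class_separated:
  assumes k: "k \<ge> 4" and e: "e \<in> color_class b (2 * k) c" and f: "f \<in> color_class b (2 * k) c"
    and ne: "e \<noteq> f"
  shows "separated_edges k e f \<or> separated_edges k f e"
proof -
  have sepI: "separated_edges k {u, v} {x, y}"
    if "separated (position k u) (position k v) (position k x) (position k y)" for u v x y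
    using that unfolding separated_edges_def by blast
  have path: ?thesis if "e \<in> path_edges (2 * k) d" "f \<in> path_edges (2 * k) d" for d
  proof -
    from that obtain i j where i: "Suc i < 2 * k" "e = {path_vertex k i, path_vertex k (Suc i)}"
      and j: "Suc j < 2 * k" "f = {path_vertex k j, path_vertex k (Suc j)}"
      and par: "even i = even j"
      unfolding path_edges_eq[OF k] by blast
    have "i \<noteq> j" using ne i j by blast
    \<comment> \<open>Equal parity keeps two distinct path edges of one color from being
      consecutive.\<close>
    with par have "Suc i < j \<or> Suc j < i" by presburger
    then show ?thesis
      unfolding i(2) j(2) using i(1) j(1) path_vertex_separated[OF k] sepI by blast
  qed
  show ?thesis
  proof (cases c)
    case Red
    then show ?thesis using path e f by simp
  next
    case Black
    then show ?thesis using path e f by simp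
  next
    case Purple
    \<comment> \<open>The endpoints have positions 4k + 1 - 2p and 2p + 3, an interval that shrinks
      as \<open>p\<close> grows, so the rungs are nested.\<close>
    have sep: "separated_edges k {2 * p, 2 * p + 3} {2 * q, 2 * q + 3}"
      if "1 \<le> p" "p < q" "q + 2 \<le> k" for p q
      using that
      by (intro sepI separated_between) (auto simp: position_def between_def)
    have "\<exists>p. e' = {2 * p, 2 * p + 3} \<and> 1 \<le> p \<and> p + 2 \<le> k" if "e' \<in> color_class b (2 * k) c" for e'
    proof -
      obtain a where "e' = {a, a + 3}" "even a" "2 \<le> a" "a \<le> 2 * k - 4"
        using \<open>e' \<in> _\<close> Purple by auto
      then show ?thesis using k by (intro exI[of _ "a div 2"]) auto
    qed
    then obtain p q where "e = {2 * p, 2 * p + 3}" "1 \<le> p" "p + 2 \<le> k"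
      "f = {2 * q, 2 * q + 3}" "1 \<le> q" "q + 2 \<le> k"
      using e f by meson
    then show ?thesis using sep[of p q] sep[of q p] ne by (cases p q rule: linorder_cases) auto
  next
    case Blue
    \<comment> \<open>Nested in the same way, with positions 2p + 1 and 4k - 3 - 2p.\<close>
    have sep: "separated_edges k {2 * p + 1, 2 * p + 4} {2 * q + 1, 2 * q + 4}"
      if "p < q" "q + 2 \<le> k" for p q
      using that
      by (intro sepI separated_between) (auto simp: position_def between_def)
    have "\<exists>p. e' = {2 * p + 1, 2 * p + 4} \<and> p + 2 \<le> k" if "e' \<in> color_class b (2 * k) c" for e'
    proof -
      obtain a where a: "e' = {a, a + 3}" "odd a" "a \<le> 2 * k - 3"
        using \<open>e' \<in> _\<close> Blue by auto
      from a(2) obtain p where "a = 2 * p + 1" by (elim oddE)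
      then show ?thesis using k a by (intro exI[of _ p]) (auto simp: add.commute)
    qed
    then obtain p q where "e = {2 * p + 1, 2 * p + 4}" "p + 2 \<le> k"
      "f = {2 * q + 1, 2 * q + 4}" "q + 2 \<le> k"
      using e f by meson
    then show ?thesis using sep[of p q] sep[of q p] ne by (cases p q rule: linorder_cases) auto
  next
    case Green
    \<comment> \<open>The first two green edges join neighbors in the cyclic order, so no vertex
      lies between their endpoints; the other two are nested.\<close>
    have "separated_edges k {2, 4} {2 * k - 3, 2 * k - 1}"
      "separated_edges k {2, 4} {3, 2 * k}" "separated_edges k {2, 4} {1, 2 * k - 2}"
      "separated_edges k {2 * k - 3, 2 * k - 1} {3, 2 * k}"
      "separated_edges k {2 * k - 3, 2 * k - 1} {1, 2 * k - 2}"
      using k by (intro sepI separated_outside; auto simp: position_def outside_def)+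
    moreover have "separated_edges k {1, 2 * k - 2} {3, 2 * k}"
      using k by (intro sepI separated_between; auto simp: position_def between_def)
    ultimately show ?thesis
      using e f ne Green by auto
  qed
qed

section \<open>The coloring and the final count\<close>

lemma edges_cross_commute: "edges_cross \<theta> e f \<longleftrightarrow> edges_cross \<theta> f e"
  unfolding edges_cross_def by (metis Un_commute)

text \<open>Covering and disjointness of the classes make the definite description in
  \<open>coloring\<close> well defined on edges.\<close>

lemma coloring_eq_iff:
  assumes "k \<ge> 4" "e \<in> edges (circulant (2 * k) {2, 3})"
  shows "coloring b (2 * k) e = c \<longleftrightarrow> e \<in> color_class b (2 * k) c"
proof -
  obtain d where d: "e \<in> color_class b (2 * k) d"
    using edges_subset_color_class[OF assms(1)] assms(2) by blast
  then have "coloring b (2 * k) e = d"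
    unfolding coloring_def using color_class_disjoint[OF assms(1)] by (intro the_equality) auto
  then show ?thesis
    using d color_class_disjoint[OF assms(1)] by blast
qed

lemma color_class_nonempty:
  assumes "k \<ge> 4"
  shows "color_class b (2 * k) c \<noteq> {}"
proof (cases c)
  case Red
  \<comment> \<open>One of the first two path edges has the required parity.\<close>
  have "Suc (if b then 0 else 1) < 2 * k \<and> even (if b then 0 else 1 :: nat) = b"
    using assms by auto
  then show ?thesis unfolding Red using path_edges_eq[OF assms] by fastforce
next
  case Black
  have "Suc (if b then 1 else 0) < 2 * k \<and> even (if b then 1 else 0 :: nat) = (\<not> b)"
    using assms by auto
  then show ?thesis unfolding Black using path_edges_eq[OF assms] by fastforce
next
  case Purple
  have "{2, 2 + 3} \<in> color_class b (2 * k) Purple"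
    using assms by fastforce
  then show ?thesis using Purple by blast
next
  case Blue
  have "{1, 1 + 3} \<in> color_class b (2 * k) Blue"
    using assms by fastforce
  then show ?thesis using Blue by blast
next
  case Green
  then show ?thesis by simp
qed

theorem theorem4:
  fixes n :: nat and red_first :: bool
  assumes "n \<ge> 8" and "even n"
  shows "matching_book_embedding (circulant n {2, 3}) (omega n) (coloring red_first n) \<and>
         nearly_dispersable (circulant n {2, 3}) (omega n) (coloring red_first n)"
proof
  obtain k where n: "n = 2 * k" and k: "k \<ge> 4"
    using assms by (auto elim!: evenE)
  let ?G = "circulant n {2, 3}"
  have verts: "verts ?G = {1..n}" by (simp add: circulant_def)
  have edge: "e \<subseteq> verts ?G \<and> card e = 2" if "e \<in> edges ?G" for e
    using that k unfolding verts unfolding n by (auto simp: edges_circulant card_insert_if)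
  show "matching_book_embedding ?G (omega n) (coloring red_first n)"
    unfolding matching_book_embedding_def
  proof (intro conjI allI ballI impI)
    show "finite_simple_graph ?G"
      using edge verts by (auto simp: finite_simple_graph_def)
    show "distinct (omega n)" by (rule distinct_omega)
    show "set (omega n) = verts ?G" unfolding verts by (rule set_omega)
    fix \<theta> e f
    assume draw: "circular_drawing (omega n) \<theta>" and e: "e \<in> edges ?G" and f: "f \<in> edges ?G"
      and ef: "e \<noteq> f \<and> coloring red_first n e = coloring red_first n f"
    have "e \<in> color_class red_first n (coloring red_first n f)"
      "f \<in> color_class red_first n (coloring red_first n f)"
      using coloring_eq_iff[OF k] e f ef unfolding n by auto
    then have sep: "separated_edges k e f \<or> separated_edges k f e"
      using color_class_separated[OF k] ef unfolding n by blast
    show "\<not> edges_cross \<theta> e f"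
      using sep separated_edges_not_cross[OF draw[unfolded n]] edge[OF e] edge[OF f]
        edges_cross_commute[of \<theta> e f]
      unfolding verts unfolding n by blast
    show "e \<inter> f = {}" using sep separated_edges_disjoint by blast
  qed
  \<comment> \<open>All five colors occur, and 4-regularity gives maximum degree 4, so 5 = 1 +
    4.\<close>
  have "coloring red_first n ` edges ?G = UNIV"
  proof -
    have "c \<in> coloring red_first n ` edges ?G" for c
      using color_class_nonempty[OF k, of red_first c] color_class_subset[OF k, of red_first c]
        coloring_eq_iff[OF k, of _ red_first c]
      unfolding n by blast
    then show ?thesis by blast
  qed
  moreover have "card (UNIV :: color set) = 5"
  proof -
    have univ: "(UNIV :: color set) = {Red, Black, Purple, Blue, Green}"
      using color.exhaust by auto
    show ?thesis by (subst univ) simp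
  qed
  moreover have "vertex_degree ?G ` verts ?G = {4}"
    using vertex_degree_circulant[OF k] k unfolding verts unfolding n by force
  ultimately show "nearly_dispersable ?G (omega n) (coloring red_first n)"
    by (simp add: nearly_dispersable_def max_degree_def)
qed

end
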